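(* Applying gradient descent on a training dataset $\{u^{(n)},f^{(n)}\}$ sampled from a function space $\mathcal{F}_{\mathrm{train}}$, the model weights $W$ will converge to the projection of the true operator $A$ onto the subspace of $\mathcal{F}_{\mathrm{train}}$. Precisely: let the forcing functions be sampled by $f^{(n)}=Bc^{(n)}$, where each component of $c$ is sampled independently with $\mathbb{E}[c_i]=0$. Optimizing the loss $$\mathcal{L}=\frac1N\sum_{n=1}^N\left\|Wf^{(n)}-u^{(n)}\right\|_2^2$$ using gradient descent with an initial condition $W^0$ will converge to $$W^*=A\,UU^T+W^0\,(I-UU^T),$$ where $U$ is the left orthogonal basis of $B$, of shape $N_{\mathrm{grid}}\times(p+1)$.
   Context: The vectors $f^{(n)},u^{(n)}\in\mathbb{R}^{N_{\mathrm{grid}}}$, $n=1,\dots,N$, are the values on a grid of $N_{\mathrm{grid}}$ points $x_i$ of a forcing function and of the corresponding solution of a linear differential equation. The matrix $A\in\mathbb{R}^{N_{\mathrm{grid}}\times N_{\mathrm{grid}}}$ is the true discrete solution operator (the discretized Green's function), and all training and test data satisfy $u=Af$. The model being trained is the linear map $f\mapsto Wf$ with $W\in\mathbb{R}^{N_{\mathrm{grid}}\times N_{\mathrm{grid}}}$. The matrix $B\in\mathbb{R}^{N_{\mathrm{grid}}\times(p+1)}$, of rank $p+1$, represents the function space $\mathcal{F}_{\mathrm{train}}$: its columns are the basis functions of that space evaluated at the grid points (for polynomials, for example, the Vandermonde matrix with rows $[1,x_i,x_i^2,\dots,x_i^p]$), and $c^{(n)}\in\mathbb{R}^{p+1}$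 is the vector of coefficients of the $n$th sample. $U$ is the left factor in the singular value decomposition $B=UDV^T$, so its columns are orthonormal and span the column space of $B$, and $UU^T$ is the orthogonal projection onto that space. $I$ is the identity matrix.
   Formalization: Convergence is for constant step sizes 0<η<2/L (L a Lipschitz constant of the gradient), with samples identically distributed and no c_i almost surely 0; it holds almost surely for all large N, and for any N whose sampled f^(n) span the column space of B. Otherwise it can fail. *)

theory Defs
  imports "HOL-Probability.Probability"
begin

text \<open>The gradient with respect to the inner product of the space. On matrices
  \<^typ>\<open>real ^ 'm ^ 'n\<close> this is the Frobenius inner product, so the gradient is the
  matrix of partial derivatives.\<close>

definition gradient :: "('a::real_inner \<Rightarrow> real) \<Rightarrow> 'a \<Rightarrow> 'a" where
  "gradient F x = (THE D. GDERIV F x :> D)"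

primrec gd_iterate :: "('a::real_inner \<Rightarrow> real) \<Rightarrow> real \<Rightarrow> 'a \<Rightarrow> nat \<Rightarrow> 'a" where
  "gd_iterate F \<eta> x0 0 = x0"
| "gd_iterate F \<eta> x0 (Suc k) =
     gd_iterate F \<eta> x0 k - \<eta> *\<^sub>R gradient F (gd_iterate F \<eta> x0 k)"

text \<open>Gradient descent diverges when the step size is too large, so convergence is required
  for every constant step size in the standard range \<open>0 < \<eta> < 2 / L\<close>, where \<open>L\<close> is a
  Lipschitz constant of the gradient; \<open>\<eta> * L < 2\<close> avoids division by zero.\<close>

definition gd_converges_to :: "('a::real_inner \<Rightarrow> real) \<Rightarrow> 'a \<Rightarrow> 'a \<Rightarrow> bool" where
  "gd_converges_to F x0 x \<longleftrightarrow>
     (\<forall>\<eta> L. 0 < \<eta> \<longrightarrow> L-lipschitz_on UNIV (gradient F) \<longrightarrow> \<eta> * L < 2 \<longrightarrow>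
        gd_iterate F \<eta> x0 \<longlonglongrightarrow> x)"

text \<open>The samples are numbered \<open>0, \<dots>, N - 1\<close>.\<close>

definition training_loss ::
  "nat \<Rightarrow> (nat \<Rightarrow> real ^ 'n) \<Rightarrow> (nat \<Rightarrow> real ^ 'n) \<Rightarrow> real ^ 'n ^ 'n \<Rightarrow> real" where
  "training_loss N f u W = 1 / real N * (\<Sum>n<N. (norm (W *v f n - u n))\<^sup>2)"

text \<open>The reduced singular value decomposition: \<open>U\<close> has the shape of \<open>B\<close>, and \<open>D\<close> is square.
  The singular values need not be sorted.\<close>

definition is_svd ::
  "real ^ 'q ^ 'n \<Rightarrow> real ^ 'q ^ 'n \<Rightarrow> real ^ 'q ^ 'q \<Rightarrow> real ^ 'q ^ 'q \<Rightarrow> bool" where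
  "is_svd B U D V \<longleftrightarrow>
     transpose U ** U = mat 1 \<and>
     orthogonal_matrix V \<and>
     (\<forall>i j. i \<noteq> j \<longrightarrow> D $ i $ j = 0) \<and> (\<forall>i. 0 \<le> D $ i $ i) \<and>
     B = U ** D ** transpose V"

end

theory Submission
  imports Defs
begin

text \<open>The loss is quadratic with a positive semidefinite Hessian \<open>T\<close>, and \<open>W\<^sup>*\<close> is a minimiser
  for which \<open>W\<^sup>0 - W\<^sup>*\<close> is orthogonal to the kernel of \<open>T\<close>, that is, to the matrices annihilating
  all samples. On the orthogonal complement of the kernel, \<open>T\<close> is coercive, so gradient descent
  contracts the error at a geometric rate.

  The samples span the column space of \<open>B\<close> almost surely for large \<open>N\<close>: every component of \<open>c\<close> has
  mean zero and is not almost surely zero, so it takes both signs with positive probability.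
  By independence every sign pattern occurs among the \<open>c\<^sup>(\<^sup>n\<^sup>)\<close> almost surely, and vectors realising
  all sign patterns span the whole space.\<close>

section \<open>Gradients and geometric convergence\<close>

lemma GDERIV_unique:
  assumes "GDERIV F x :> D" "GDERIV F x :> D'"
  shows "D = D'"
proof -
  have "(\<lambda>h. inner h D) = (\<lambda>h. inner h D')"
    using assms unfolding gderiv_def by (rule has_derivative_unique)
  then have "inner (D - D') D = inner (D - D') D'"
    by meson
  then have "inner (D - D') (D - D') = 0"
    by (simp add: inner_diff_right)
  then show ?thesis by simp
qed

lemma gradient_eqI: "GDERIV F x :> D \<Longrightarrow> gradient F x = D"
  unfolding gradient_def by (blast intro: GDERIV_unique)

lemma contracting_seq_tendsto_0:
  fixes e :: "nat \<Rightarrow> 'a::real_normed_vector" and q :: real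
  assumes step: "\<And>k. (norm (e (Suc k)))\<^sup>2 \<le> q * (norm (e k))\<^sup>2" and "q < 1"
  shows "e \<longlonglongrightarrow> 0"
proof -
  \<comment> \<open>The sign of \<open>q\<close> is unknown, and the induction multiplies an
    inequality by the rate, so a nonnegative rate replaces it.\<close>
  define r where "r = max 0 q"
  have r: "0 \<le> r" "r < 1" "q \<le> r"
    using \<open>q < 1\<close> by (auto simp: r_def)
  have bound: "(norm (e k))\<^sup>2 \<le> r ^ k * (norm (e 0))\<^sup>2" for k
  proof (induction k)
    case (Suc k)
    have "(norm (e (Suc k)))\<^sup>2 \<le> r * (norm (e k))\<^sup>2"
      using step[of k] mult_right_mono[OF r(3), of "(norm (e k))\<^sup>2"] by simp
    also have "\<dots> \<le> r * (r ^ k * (norm (e 0))\<^sup>2)"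
      using Suc r(1) by (rule mult_left_mono)
    finally show ?case by (simp add: mult.assoc)
  qed simp
  have "(\<lambda>k. r ^ k * (norm (e 0))\<^sup>2) \<longlonglongrightarrow> 0"
    using r by (intro tendsto_mult_left_zero LIMSEQ_realpow_zero) auto
  then have "(\<lambda>k. (norm (e k))\<^sup>2) \<longlonglongrightarrow> 0"
    by (rule Lim_null_comparison[rotated]) (simp add: bound)
  then have "(\<lambda>k. norm (e k)) \<longlonglongrightarrow> 0"
    by (rule power_tendsto_0_iff[THEN iffD1, rotated]) simp
  then show ?thesis
    by (rule tendsto_norm_zero_cancel)
qed

section \<open>Positive semidefinite operators and gradient descent on quadratics\<close>

text \<open>Cocoercivity: the quadratic form of \<open>T\<close> is nonnegative at
  \<open>x - (1 / L) *\<^sub>R T x\<close>. Expanding it there and bounding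
  \<open>inner (T x) (T (T x))\<close> by Cauchy-Schwarz leaves the claim.\<close>

lemma psd_image_norm_le:
  fixes T :: "'a::real_inner \<Rightarrow> 'a"
  assumes "linear T"
    and sym: "\<And>x y. inner (T x) y = inner x (T y)"
    and psd: "\<And>x. 0 \<le> inner x (T x)"
    and bound: "\<And>x. norm (T x) \<le> L * norm x"
  shows "(norm (T x))\<^sup>2 \<le> L * inner x (T x)"
proof (cases "L > 0")
  case True
  interpret linear T by fact
  have "inner (T x) (T (T x)) \<le> norm (T x) * norm (T (T x))"
    by (rule norm_cauchy_schwarz)
  also have "\<dots> \<le> norm (T x) * (L * norm (T x))"
    by (intro mult_left_mono bound) simp
  finally have b: "inner (T x) (T (T x)) \<le> L * (norm (T x))\<^sup>2"
    by (simp add: power2_eq_square mult_ac)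
  have "0 \<le> L\<^sup>2 * inner (x - (1 / L) *\<^sub>R T x) (T (x - (1 / L) *\<^sub>R T x))"
    by (intro mult_nonneg_nonneg psd) simp
  also have "\<dots> = L\<^sup>2 * inner x (T x) - 2 * L * (norm (T x))\<^sup>2 + inner (T x) (T (T x))"
    using True sym[of x "T x"] unfolding power2_norm_eq_inner
    by (simp add: diff scale inner_diff_left inner_diff_right power2_eq_square field_simps)
  also have "\<dots> \<le> L\<^sup>2 * inner x (T x) - L * (norm (T x))\<^sup>2"
    using b by simp
  finally have "L * (norm (T x))\<^sup>2 \<le> L * (L * inner x (T x))"
    by (simp add: power2_eq_square mult.assoc)
  then show ?thesis using True by simp
next
  case False
  \<comment> \<open>For \<open>L\<close> \<le> 0 the norm bound forces \<open>T\<close> to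
    vanish.\<close>
  have *: "norm (T y) = 0" for y
  proof -
    have "L * norm y \<le> 0" using False by (simp add: mult_nonpos_nonneg)
    then show ?thesis using bound[of y] norm_ge_zero[of "T y"] by linarith
  qed
  have "T x = 0" using *[of x] by simp
  then show ?thesis by simp
qed

text \<open>By compactness the quadratic form attains its minimum on the unit sphere of the
  orthogonal complement of the kernel. The minimum is positive and serves as \<open>m\<close>;
  scaling extends the bound to the whole complement.\<close>

lemma psd_coercive_on_orthogonal_complement:
  fixes T :: "'a::euclidean_space \<Rightarrow> 'a"
  assumes "linear T"
    and sym: "\<And>x y. inner (T x) y = inner x (T y)"
    and psd: "\<And>x. 0 \<le> inner x (T x)"
  obtains m where "m > 0"
    "\<And>x. (\<And>y. T y = 0 \<Longrightarrow> inner x y = 0) \<Longrightarrow> m * (norm x)\<^sup>2 \<le> inner x (T x)"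
proof -
  interpret linear T by fact
  define R where "R = {x. \<forall>y. T y = 0 \<longrightarrow> inner x y = 0}"
  have R_scale: "a *\<^sub>R x \<in> R" if "x \<in> R" for a x
    using that by (simp add: R_def)
  obtain K where K: "\<And>x. norm (T x) \<le> K * norm x"
    using linear_bounded[OF \<open>linear T\<close>] by blast
  have pos: "0 < inner x (T x)" if "x \<in> R" "x \<noteq> 0" for x
  proof (rule ccontr)
    assume "\<not> 0 < inner x (T x)"
    then have "inner x (T x) = 0" using psd[of x] by simp
    \<comment> \<open>A zero of the form lies in the kernel, by the cocoercivity bound; being in
      \<open>R\<close> as well, it is orthogonal to itself.\<close>
    then have "T x = 0"
      using psd_image_norm_le[OF \<open>linear T\<close> sym psd K, of x] by simp
    then show False using that by (auto simp: R_def)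
  qed
  have "closed R"
  proof -
    have "R = (\<Inter>y\<in>{y. T y = 0}. {x. inner x y = 0})" by (auto simp: R_def)
    moreover have "closed {x. inner x y = 0}" for y :: 'a
      by (intro closed_Collect_eq continuous_intros)
    ultimately show ?thesis by auto
  qed
  then have cpt: "compact (sphere 0 1 \<inter> R)"
    by (intro compact_Int_closed) auto
  show thesis
  proof (cases "sphere 0 1 \<inter> R = {}")
    case True
    have "x = 0" if "x \<in> R" for x
    proof (rule ccontr)
      assume "x \<noteq> 0"
      then have "(1 / norm x) *\<^sub>R x \<in> sphere 0 1 \<inter> R"
        using R_scale[OF that] by simp
      then show False using True by blast
    qed
    \<comment> \<open>The complement is trivial here, so any positive constant would do.\<close>
    then show thesis
      by (intro that[of 1]) (fastforce simp: R_def zero)+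
  next
    case False
    have "continuous_on (sphere 0 1 \<inter> R) (\<lambda>x. inner x (T x))"
      using \<open>linear T\<close> by (intro continuous_intros linear_continuous_on linear_linear[THEN iffD2])
        (auto simp: linear_conv_bounded_linear)
    then obtain z where z: "z \<in> sphere 0 1 \<inter> R"
      and min: "\<And>x. x \<in> sphere 0 1 \<inter> R \<Longrightarrow> inner z (T z) \<le> inner x (T x)"
      using continuous_attains_inf[OF cpt False] by blast
    have "inner z (T z) * (norm x)\<^sup>2 \<le> inner x (T x)" if "x \<in> R" for x
    proof (cases "x = 0")
      case False
      have "inner z (T z) \<le> inner ((1 / norm x) *\<^sub>R x) (T ((1 / norm x) *\<^sub>R x))"
        using False R_scale[OF that] by (intro min) simp
      then show ?thesis
        using False by (simp add: scale power2_eq_square field_simps)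
    qed simp
    moreover have "0 < inner z (T z)" using z by (intro pos) auto
    ultimately show thesis by (intro that) (auto simp: R_def)
  qed
qed

text \<open>A component of the initial error in the kernel of the Hessian \<open>T\<close> would never change;
  on the orthogonal complement of the kernel, gradient descent is a contraction.\<close>

lemma gd_converges_to_quadratic:
  fixes T :: "'a::euclidean_space \<Rightarrow> 'a"
  assumes "linear T"
    and sym: "\<And>x y. inner (T x) y = inner x (T y)"
    and psd: "\<And>x. 0 \<le> inner x (T x)"
    and grad: "\<And>x. GDERIV F x :> T (x - z)"
    and orth: "\<And>y. T y = 0 \<Longrightarrow> inner (x0 - z) y = 0"
  shows "gd_converges_to F x0 z"
  unfolding gd_converges_to_def
proof (intro allI impI)
  fix \<eta> L :: real
  assume \<eta>: "0 < \<eta>" and lip: "L-lipschitz_on UNIV (gradient F)" and \<eta>L: "\<eta> * L < 2"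
  interpret linear T by fact
  have gradient: "gradient F x = T (x - z)" for x
    by (rule gradient_eqI[OF grad])
  \<comment> \<open>The gradients at \<open>x + z\<close> and at \<open>z\<close> differ by
    \<open>T x\<close>, so \<open>L\<close> bounds the operator norm of \<open>T\<close>.\<close>
  have bound: "norm (T x) \<le> L * norm x" for x
    using lipschitz_onD[OF lip, of "x + z" z] by (simp add: gradient dist_norm zero)
  obtain m where m: "m > 0"
    "\<And>x. (\<And>y. T y = 0 \<Longrightarrow> inner x y = 0) \<Longrightarrow> m * (norm x)\<^sup>2 \<le> inner x (T x)"
    using psd_coercive_on_orthogonal_complement[OF \<open>linear T\<close> sym psd] by blast
  define e where "e k = gd_iterate F \<eta> x0 k - z" for k
  have e_Suc: "e (Suc k) = e k - \<eta> *\<^sub>R T (e k)" for k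
    by (simp add: e_def gradient)
  \<comment> \<open>By symmetry the range of \<open>T\<close> is orthogonal to its kernel, so no
    update leaves the complement.\<close>
  have e_orth: "inner (e k) y = 0" if "T y = 0" for k y
  proof (induction k)
    case 0
    then show ?case using orth[OF that] by (simp add: e_def)
  next
    case (Suc k)
    then show ?case using that by (simp add: e_Suc inner_diff_left sym)
  qed
  \<comment> \<open>Expanding the square produces a term in \<open>norm (T x)\<close>, which
    cocoercivity absorbs into \<open>inner x (T x)\<close>. The remaining factor
    \<open>2 - \<eta> * L\<close> is positive exactly by the step size condition, so coercivity
    applies.\<close>
  have "(norm (e (Suc k)))\<^sup>2 \<le> (1 - \<eta> * (2 - \<eta> * L) * m) * (norm (e k))\<^sup>2" for k
  proof -
    define x where "x = e k"
    have "(norm (e (Suc k)))\<^sup>2 = (norm x)\<^sup>2 - 2 * \<eta> * inner x (T x) + \<eta>\<^sup>2 * (norm (T x))\<^sup>2"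
      unfolding power2_norm_eq_inner
      by (simp add: e_Suc x_def inner_diff_left inner_diff_right inner_commute power2_eq_square)
    also have "\<dots> \<le> (norm x)\<^sup>2 - 2 * \<eta> * inner x (T x) + \<eta>\<^sup>2 * (L * inner x (T x))"
      using psd_image_norm_le[OF \<open>linear T\<close> sym psd bound]
      by (intro add_left_mono mult_left_mono) auto
    also have "\<dots> = (norm x)\<^sup>2 - \<eta> * (2 - \<eta> * L) * inner x (T x)"
      by (simp add: power2_eq_square algebra_simps)
    also have "\<dots> \<le> (norm x)\<^sup>2 - \<eta> * (2 - \<eta> * L) * (m * (norm x)\<^sup>2)"
      using \<eta> \<eta>L e_orth by (intro diff_left_mono mult_left_mono m(2)) (auto simp: x_def)
    finally show ?thesis by (simp add: x_def algebra_simps)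
  qed
  moreover have "1 - \<eta> * (2 - \<eta> * L) * m < 1"
    using \<eta> \<eta>L m(1) by simp
  ultimately have "e \<longlonglongrightarrow> 0"
    by (rule contracting_seq_tendsto_0)
  then show "gd_iterate F \<eta> x0 \<longlonglongrightarrow> z"
    unfolding e_def by (simp add: LIM_zero_iff)
qed

section \<open>The training loss as a quadratic function of the weights\<close>

text \<open>The rank-one product of a column \<open>a\<close> and a row \<open>b\<close>. Up to a
  factor 2, the gradient of one squared residual is the product of the residual with its
  input.\<close>

definition outer :: "real ^ 'n \<Rightarrow> real ^ 'm \<Rightarrow> real ^ 'm ^ 'n" where
  "outer a b = (\<chi> i. (a $ i) *\<^sub>R b)"

lemma inner_outer: "inner (outer a b) Y = inner a (Y *v b)"
  by (simp add: outer_def inner_vec_def matrix_vector_mult_def sum_distrib_left mult_ac)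

lemma linear_outer_left: "linear (\<lambda>a. outer a b)"
  by (rule linearI) (simp_all add: outer_def vec_eq_iff algebra_simps)

text \<open>Used to move the trailing \<open>transpose U\<close> of the initial error onto a matrix
  \<open>Y\<close>, where it becomes the vanishing product \<open>Y ** U\<close>.\<close>

lemma inner_matrix_mult_left:
  fixes X :: "real ^ 'q ^ 'n" and Z :: "real ^ 'm ^ 'q"
  shows "inner (X ** Z) Y = inner X (Y ** transpose Z)"
  unfolding inner_vec_def matrix_matrix_mult_def transpose_def
  apply (simp add: sum_distrib_left sum_distrib_right)
  apply (subst sum.swap)
  apply (simp add: mult_ac)
  done

lemma linear_matrix_vector_mult_left: "linear (\<lambda>W :: real ^ 'm ^ 'n. W *v b)"
  by (rule linearI) (simp_all add: matrix_vector_mult_add_rdistrib scaleR_matrix_vector_assoc)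

lemma GDERIV_training_loss:
  "GDERIV (training_loss N f u) W :> (2 / real N) *\<^sub>R (\<Sum>n<N. outer (W *v f n - u n) (f n))"
proof -
  have lin: "bounded_linear (\<lambda>W. W *v f n)" for n
    using linear_matrix_vector_mult_left by (simp add: linear_conv_bounded_linear)
  \<comment> \<open>With a generic constant \<open>r\<close>, the case \<open>N = 0\<close>, where
    \<open>1 / real N\<close> is 0, needs no separate argument.\<close>
  have "((\<lambda>W. r * (\<Sum>n<N. inner (W *v f n - u n) (W *v f n - u n))) has_derivative
      (\<lambda>h. r * (\<Sum>n<N. inner (W *v f n - u n) (h *v f n) +
        inner (h *v f n) (W *v f n - u n)))) (at W)" for r
    by (auto intro!: derivative_eq_intros bounded_linear_imp_has_derivative[OF lin] simp: fun_eq_iff)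
  moreover have "inner h ((2 / real N) *\<^sub>R (\<Sum>n<N. outer (W *v f n - u n) (f n))) =
      1 / real N * (\<Sum>n<N. inner (W *v f n - u n) (h *v f n) +
        inner (h *v f n) (W *v f n - u n))" for h
    by (simp add: inner_sum_right inner_commute[of h] inner_outer inner_commute[of "h *v _"]
        sum.distrib inner_sum_left flip: sum_distrib_left)
  ultimately show ?thesis
    unfolding gderiv_def training_loss_def power2_norm_eq_inner by presburger
qed

text \<open>Since \<open>Z\<close> fits every sample, the residual at \<open>W\<close> is
  \<open>(W - Z) *v f n\<close>. The gradient is therefore a positive semidefinite operator applied
  to \<open>W - Z\<close>, and its kernel consists of the matrices annihilating all samples.\<close>

lemma gd_converges_to_training_loss:
  fixes A W0 Z :: "real ^ 'n ^ 'n"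
  assumes u: "\<And>n. n < N \<Longrightarrow> u n = A *v f n"
    and fit: "\<And>n. n < N \<Longrightarrow> Z *v f n = A *v f n"
    and orth: "\<And>Y. (\<And>n. n < N \<Longrightarrow> Y *v f n = 0) \<Longrightarrow> inner (W0 - Z) Y = 0"
  shows "gd_converges_to (training_loss N f u) W0 Z"
proof -
  define T where "T X = (2 / real N) *\<^sub>R (\<Sum>n<N. outer (X *v f n) (f n))" for X :: "real ^ 'n ^ 'n"
  have T_inner: "inner (T X) Y = 2 / real N * (\<Sum>n<N. inner (X *v f n) (Y *v f n))" for X Y
    by (simp add: T_def inner_sum_left inner_outer)
  show ?thesis
  proof (rule gd_converges_to_quadratic)
    show "linear T"
      unfolding T_def
      by (intro linear_compose_scale_right linear_compose_sum ballI
          linear_compose[OF linear_matrix_vector_mult_left linear_outer_left, unfolded o_def])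
    show "inner (T X) Y = inner X (T Y)" for X Y
      by (simp add: T_inner inner_commute[of X] inner_commute[of "Y *v _"])
    show "0 \<le> inner X (T X)" for X
      by (simp add: inner_commute[of X] T_inner sum_nonneg)
    show "GDERIV (training_loss N f u) W :> T (W - Z)" for W
    proof (rule GDERIV_subst[OF GDERIV_training_loss])
      show "(2 / real N) *\<^sub>R (\<Sum>n<N. outer (W *v f n - u n) (f n)) = T (W - Z)"
        unfolding T_def by (simp add: u fit matrix_vector_mult_diff_rdistrib)
    qed
    show "inner (W0 - Z) Y = 0" if "T Y = 0" for Y
    proof (rule orth)
      \<comment> \<open>\<open>inner (T Y) Y\<close> is this sum of squares times
        \<open>2 / real N\<close>. For \<open>N = 0\<close> the factor is 0, but the sum is
        empty.\<close>
      have "(\<Sum>n<N. inner (Y *v f n) (Y *v f n)) = 0"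
        using T_inner[of Y Y] that by (cases "N = 0") auto
      then have "\<forall>n\<in>{..<N}. inner (Y *v f n) (Y *v f n) = 0"
        by (subst (asm) sum_nonneg_eq_0_iff) auto
      then show "Y *v f n = 0" if "n < N" for n
        using that by simp
    qed
  qed
qed

section \<open>The projection onto the column space\<close>

text \<open>A product has rank at most that of its right factor, so the square matrix
  \<open>G\<close> is invertible and \<open>H\<close> is its inverse. For a singular value
  decomposition this puts the columns of \<open>U\<close> into the column space of
  \<open>B\<close>.\<close>

lemma full_column_rank_left_factor:
  fixes B U :: "real ^ 'q ^ 'n"
  assumes "rank B = CARD('q)" and "B = U ** G"
  obtains H where "B ** H = U"
proof -
  have "CARD('q) \<le> rank G"
    using rank_mul_le_right[of U G] assms by simp
  then have "rank G = CARD('q)" using rank_bound[of G] by simp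
  then obtain H where "H ** G = mat 1"
    unfolding full_rank_injective matrix_left_invertible_injective[symmetric] by blast
  then have "G ** H = mat 1"
    by (simp only: matrix_left_right_inverse)
  then have "B ** H = U"
    unfolding assms(2) by (simp flip: matrix_mul_assoc)
  then show thesis by (rule that)
qed

lemma span_columns_eq_range:
  fixes B :: "real ^ 'q ^ 'n"
  shows "span (columns B) = range ((*v) B)"
proof
  show "span (columns B) \<subseteq> range ((*v) B)"
    by (intro span_minimal linear_subspace_image) (auto simp: columns_image_basis)
  show "range ((*v) B) \<subseteq> span (columns B)"
    using matrix_vector_mult_in_columnspace by blast
qed

text \<open>The projection fixes every sample, so the claimed limit acts on samples as
  \<open>A\<close> does. A matrix annihilating the samples annihilates the columns of
  \<open>B\<close>, hence those of \<open>U\<close>, while the rows of the initial error are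
  combinations of columns of \<open>U\<close>.\<close>

lemma gd_converges_to_projection:
  fixes A W0 :: "real ^ 'n ^ 'n" and B U :: "real ^ 'q ^ 'n"
  assumes rank: "rank B = CARD('q)"
    and svd: "is_svd B U D V"
    and u: "\<And>n. n < N \<Longrightarrow> u n = A *v f n"
    and span: "span (f ` {..<N}) = span (columns B)"
  shows "gd_converges_to (training_loss N f u) W0
    (A ** U ** transpose U + W0 ** (mat 1 - U ** transpose U))"
proof (rule gd_converges_to_training_loss)
  let ?Z = "A ** U ** transpose U + W0 ** (mat 1 - U ** transpose U)"
  have UU: "transpose U ** U = mat 1" and B: "B = U ** (D ** transpose V)"
    using svd by (simp_all add: is_svd_def matrix_mul_assoc)
  show "u n = A *v f n" if "n < N" for n
    using that by (rule u)
  show "?Z *v f n = A *v f n" if "n < N" for n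
  proof -
    have "f n \<in> span (columns B)" using that unfolding span[symmetric] by (intro span_base) simp
    then obtain c where c: "f n = B *v c" using span_columns_eq_range by auto
    have "U ** transpose U ** B = U ** (transpose U ** U) ** (D ** transpose V)"
      by (simp only: B matrix_mul_assoc)
    also have "\<dots> = B" by (simp add: UU B)
    finally have "(U ** transpose U) *v f n = f n"
      by (simp add: c matrix_vector_mul_assoc)
    then have "A ** U ** transpose U *v f n = A *v f n"
       "(W0 ** (mat 1 - U ** transpose U)) *v f n = 0"
      by (simp_all flip: matrix_vector_mul_assoc add: matrix_mul_assoc[symmetric]
         matrix_vector_mult_diff_rdistrib)
    then show ?thesis by (simp add: matrix_vector_mult_add_rdistrib)
  qed
  fix Y :: "real ^ 'n ^ 'n"
  assume Y: "\<And>n. n < N \<Longrightarrow> Y *v f n = 0"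
  have "Y *v x = 0" if "x \<in> span (f ` {..<N})" for x
    using that
    by (rule linear_eq_0_on_span[OF matrix_vector_mul_linear, rotated]) (use Y in auto)
  then have "Y ** B = 0"
    unfolding span span_columns_eq_range by (simp add: matrix_eq flip: matrix_vector_mul_assoc)
  \<comment> \<open>Full rank enters here: otherwise some column of \<open>U\<close> could lie
    outside the column space of \<open>B\<close>.\<close>
  moreover obtain H where H: "B ** H = U"
    using full_column_rank_left_factor[OF rank B] .
  moreover have "Y ** U = (Y ** B) ** H"
    by (simp add: H flip: matrix_mul_assoc)
  ultimately have YU: "Y ** U = 0"
    by simp
  have diff: "W0 - ?Z = (W0 - A) ** U ** transpose U"
    by (simp add: matrix_eq matrix_vector_mult_diff_rdistrib matrix_vector_mult_diff_distrib
        matrix_vector_mult_add_rdistrib flip: matrix_vector_mul_assoc)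
  show "inner (W0 - ?Z) Y = 0"
    unfolding diff by (simp add: inner_matrix_mult_left YU)
qed

section \<open>Random coefficient vectors eventually span\<close>

text \<open>Otherwise \<open>- X\<close> would be almost surely nonnegative with integral zero,
  hence almost surely zero.\<close>

lemma (in prob_space) centered_prob_pos:
  fixes X :: "'a \<Rightarrow> real"
  assumes X: "integrable M X" "expectation X = 0" "\<not> (AE \<omega> in M. X \<omega> = 0)"
  shows "0 < prob (X -` {0<..} \<inter> space M)"
proof (rule ccontr)
  have meas: "X -` {0<..} \<inter> space M \<in> events"
    using borel_measurable_integrable[OF X(1)] by measurable
  assume "\<not> 0 < prob (X -` {0<..} \<inter> space M)"
  then have "prob (X -` {0<..} \<inter> space M) = 0"
    using measure_nonneg[of M "X -` {0<..} \<inter> space M"] by linarith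
  then have "AE \<omega> in M. \<omega> \<notin> X -` {0<..} \<inter> space M"
    using meas by (simp add: prob_eq_0)
  then have "AE \<omega> in M. 0 \<le> - X \<omega>"
    using AE_space by eventually_elim auto
  then have "AE \<omega> in M. - X \<omega> = 0"
    using X by (subst integral_nonneg_eq_0_iff_AE[symmetric]) auto
  then show False using X(3) by simp
qed

text \<open>Both signs are strict, so that matching signs give a positive product. Coding signs as
  booleans leaves only finitely many patterns on a finite index type.\<close>

definition sign_set :: "bool \<Rightarrow> real set" where
  "sign_set b = (if b then {0<..} else {..<0})"

lemma sign_set_borel [measurable]: "sign_set b \<in> sets borel"
  by (simp add: sign_set_def)

lemma (in prob_space) centered_prob_sign_pos:
  fixes X :: "'a \<Rightarrow> real"
  assumes "integrable M X" "expectation X = 0" "\<not> (AE \<omega> in M. X \<omega> = 0)"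
  shows "0 < prob (X -` sign_set b \<inter> space M)"
proof (cases b)
  case True
  then show ?thesis using centered_prob_pos[OF assms] by (simp add: sign_set_def)
next
  case False
  have "(\<lambda>\<omega>. - X \<omega>) -` {0<..} = X -` {..<0}" by auto
  then show ?thesis using centered_prob_pos[of "\<lambda>\<omega>. - X \<omega>"] assms False
    by (simp add: sign_set_def)
qed

text \<open>By independence, the first \<open>k + 1\<close> trials all miss with probability
  \<open>(1 - p) ^ Suc k\<close>, which tends to 0.\<close>

lemma (in prob_space) indep_vars_AE_hit:
  fixes Y :: "nat \<Rightarrow> 'a \<Rightarrow> 'b"
  assumes ind: "indep_vars N Y UNIV"
    and S: "\<And>n. S n \<in> sets (N n)"
    and p: "\<And>n. prob (Y n -` S n \<inter> space M) = p" and "0 < p"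
  shows "AE \<omega> in M. \<exists>n. Y n \<omega> \<in> S n"
proof -
  have rv: "Y n \<in> measurable M (N n)" for n
    using ind by (simp add: indep_vars_def)
  define E where "E n = Y n -` (space (N n) - S n) \<inter> space M" for n
  have E: "E n \<in> events" for n
    unfolding E_def using rv S by (intro measurable_sets[OF rv]) auto
  have prob_E: "prob (E n) = 1 - p" for n
  proof -
    have "E n = space M - (Y n -` S n \<inter> space M)"
      using measurable_space[OF rv] by (auto simp: E_def)
    then show ?thesis
      using prob_compl[of "Y n -` S n \<inter> space M"] measurable_sets[OF rv S] p by simp
  qed
  have bound: "prob (\<Inter>n. E n) \<le> (1 - p) ^ Suc k" for k
  proof -
    have "prob (\<Inter>n. E n) \<le> prob (\<Inter>n\<in>{..k}. E n)"
      using E by (intro finite_measure_mono) auto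
    also have "\<dots> = (\<Prod>n\<in>{..k}. prob (E n))"
      unfolding E_def by (rule indep_varsD[OF ind]) (use S in auto)
    finally show ?thesis by (simp add: prob_E)
  qed
  have "(\<lambda>k. (1 - p) ^ Suc k) \<longlonglongrightarrow> 0"
    using \<open>0 < p\<close> prob_E[of 0] measure_nonneg[of M "E 0"]
    by (intro LIMSEQ_Suc LIMSEQ_realpow_zero) auto
  then have "prob (\<Inter>n. E n) \<le> 0"
    by (rule LIMSEQ_le_const) (use bound in auto)
  then have "prob (\<Inter>n. E n) = 0"
    by (simp add: measure_le_0_iff)
  then have "AE \<omega> in M. \<omega> \<notin> (\<Inter>n. E n)"
    using E by (subst prob_eq_0[symmetric]) auto
  then show ?thesis
    using AE_space
  proof eventually_elim
    case (elim \<omega>)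
    then show ?case using measurable_space[OF rv] by (auto simp: E_def)
  qed
qed

text \<open>Each sample matches the pattern with the same positive probability, the product over its
  components, and distinct samples are independent trials.\<close>

lemma (in prob_space) AE_sign_pattern_occurs:
  fixes c :: "nat \<Rightarrow> 'a \<Rightarrow> real ^ 'q"
  assumes ind: "indep_vars (\<lambda>_. borel) (\<lambda>(n, i) \<omega>. c n \<omega> $ i) (UNIV :: (nat \<times> 'q) set)"
    and distr: "\<And>n i. distr M borel (\<lambda>\<omega>. c n \<omega> $ i) = distr M borel (\<lambda>\<omega>. c 0 \<omega> $ i)"
    and int: "\<And>n i. integrable M (\<lambda>\<omega>. c n \<omega> $ i)"
    and mean: "\<And>n i. expectation (\<lambda>\<omega>. c n \<omega> $ i) = 0"
    and nontrivial: "\<And>n i. \<not> (AE \<omega> in M. c n \<omega> $ i = 0)"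
  shows "AE \<omega> in M. \<exists>n. \<forall>i. c n \<omega> $ i \<in> sign_set (s i)"
proof -
  define X where "X = (\<lambda>(n, i) \<omega>. c n \<omega> $ i :: real)"
  have ind': "indep_vars (\<lambda>_. borel) X UNIV"
    using ind by (simp add: X_def)
  \<comment> \<open>\<open>K n\<close> collects the indices of sample \<open>n\<close>. These blocks
    are disjoint, so independence of all components passes to independence of the vectors.\<close>
  define K where "K n = {n} \<times> (UNIV :: 'q set)" for n :: nat
  define S where "S n = (\<Pi>\<^sub>E j\<in>K n. sign_set (s (snd j)))" for n
  \<comment> \<open>Sample 0 is the reference: each component has the same distribution in every
    sample.\<close>
  define p where "p = (\<Prod>i\<in>UNIV. prob ((\<lambda>\<omega>. c 0 \<omega> $ i) -` sign_set (s i) \<inter> space M))"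
  have hit: "restrict (\<lambda>j. X j \<omega>) (K n) \<in> S n \<longleftrightarrow> (\<forall>i. c n \<omega> $ i \<in> sign_set (s i))" for n \<omega>
    by (auto simp: S_def K_def X_def PiE_iff)
  have "AE \<omega> in M. \<exists>n. restrict (\<lambda>j. X j \<omega>) (K n) \<in> S n"
  proof (rule indep_vars_AE_hit)
    show "indep_vars (\<lambda>n. PiM (K n) (\<lambda>_. borel)) (\<lambda>n \<omega>. restrict (\<lambda>j. X j \<omega>) (K n)) UNIV"
      by (rule indep_vars_restrict[OF ind']) (auto simp: K_def disjoint_family_on_def)
    show "S n \<in> sets (PiM (K n) (\<lambda>_. borel))" for n
      unfolding S_def by (intro sets_PiM_I_finite) (auto simp: K_def)
    show "0 < p"
      unfolding p_def using centered_prob_sign_pos[OF int mean nontrivial]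
      by (intro prod_pos) auto
    show "prob ((\<lambda>\<omega>. restrict (\<lambda>j. X j \<omega>) (K n)) -` S n \<inter> space M) = p" for n
    proof -
      have "(\<lambda>\<omega>. restrict (\<lambda>j. X j \<omega>) (K n)) -` S n \<inter> space M =
          {\<omega> \<in> space M. \<forall>i. c n \<omega> $ i \<in> sign_set (s i)}"
        by (auto simp: vimage_def hit)
      also have "\<dots> = (\<Inter>j\<in>K n. X j -` sign_set (s (snd j)) \<inter> space M)"
        by (auto simp: K_def X_def)
      also have "prob \<dots> = (\<Prod>j\<in>K n. prob (X j -` sign_set (s (snd j)) \<inter> space M))"
        by (rule indep_varsD[OF ind']) (auto simp: K_def)
      also have "\<dots> = (\<Prod>i\<in>UNIV. prob ((\<lambda>\<omega>. c n \<omega> $ i) -` sign_set (s i) \<inter> space M))"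
        unfolding K_def by (rule prod.reindex_bij_witness[of _ "\<lambda>i. (n, i)" snd]) (auto simp: X_def)
      also have "\<dots> = p"
        unfolding p_def
      proof (rule prod.cong[OF refl])
        fix i
        have "measure (distr M borel (\<lambda>\<omega>. c n \<omega> $ i)) (sign_set (s i)) =
            measure (distr M borel (\<lambda>\<omega>. c 0 \<omega> $ i)) (sign_set (s i))"
          by (simp add: distr[of n])
        then show "prob ((\<lambda>\<omega>. c n \<omega> $ i) -` sign_set (s i) \<inter> space M) =
            prob ((\<lambda>\<omega>. c 0 \<omega> $ i) -` sign_set (s i) \<inter> space M)"
          using int by (simp add: measure_distr borel_measurable_integrable)
      qed
      finally show ?thesis .
    qed
  qed
  then show ?thesis by (simp add: hit)
qed

text \<open>A nonzero vector orthogonal to \<open>C\<close> would have positive inner product with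
  the element of \<open>C\<close> that matches its signs.\<close>

lemma span_eq_UNIV_if_all_sign_patterns:
  fixes C :: "(real ^ 'q) set"
  assumes "\<And>s. \<exists>x\<in>C. \<forall>i. x $ i \<in> sign_set (s i)"
  shows "span C = UNIV"
proof (rule ccontr)
  assume "span C \<noteq> UNIV"
  then obtain a where a: "a \<noteq> 0" "\<And>x. x \<in> span C \<Longrightarrow> inner a x = 0"
    using span_not_UNIV_orthogonal by blast
  \<comment> \<open>Where \<open>a $ i = 0\<close> the pattern asks for a negative entry, but the
    product is 0 anyway.\<close>
  obtain x where x: "x \<in> C" "\<And>i. x $ i \<in> sign_set (0 < a $ i)"
    using assms[of "\<lambda>i. 0 < a $ i"] by blast
  have nonneg: "0 \<le> a $ i * x $ i" for i
    using x(2)[of i] by (auto simp: sign_set_def mult_nonpos_nonpos split: if_splits)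
  obtain i where "a $ i \<noteq> 0" using a(1) by (auto simp: vec_eq_iff)
  then have "0 < a $ i * x $ i"
    using x(2)[of i] by (auto simp: sign_set_def mult_neg_neg split: if_splits)
  then have "0 < inner a x"
    unfolding inner_vec_def using nonneg by (auto intro!: sum_pos2[of _ i])
  then show False using a(2)[of x] x(1) span_base by force
qed

text \<open>There are finitely many sign patterns, so almost surely all occur, and all have occurred
  after finitely many samples.\<close>

lemma (in prob_space) AE_eventually_span_samples_eq_UNIV:
  fixes c :: "nat \<Rightarrow> 'a \<Rightarrow> real ^ 'q"
  assumes "indep_vars (\<lambda>_. borel) (\<lambda>(n, i) \<omega>. c n \<omega> $ i) (UNIV :: (nat \<times> 'q) set)"
    and "\<And>n i. distr M borel (\<lambda>\<omega>. c n \<omega> $ i) = distr M borel (\<lambda>\<omega>. c 0 \<omega> $ i)"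
    and "\<And>n i. integrable M (\<lambda>\<omega>. c n \<omega> $ i)"
    and "\<And>n i. expectation (\<lambda>\<omega>. c n \<omega> $ i) = 0"
    and "\<And>n i. \<not> (AE \<omega> in M. c n \<omega> $ i = 0)"
  shows "AE \<omega> in M. \<forall>\<^sub>F N in sequentially. span ((\<lambda>n. c n \<omega>) ` {..<N}) = UNIV"
proof -
  have "AE \<omega> in M. \<forall>s. \<exists>n. \<forall>i. c n \<omega> $ i \<in> sign_set (s i)"
    using AE_sign_pattern_occurs[OF assms]
    by (subst AE_all_countable) auto
  then show ?thesis
  proof eventually_elim
    case (elim \<omega>)
    then obtain n where n: "\<And>s i. c (n s) \<omega> $ i \<in> sign_set (s i)" by metis
    show ?case
      unfolding eventually_sequentially
    proof (intro exI allI impI)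
      \<comment> \<open>\<open>n s\<close> is an index at which pattern \<open>s\<close> occurs.
        Indices start at 0 and range below \<open>N\<close>, hence the \<open>Suc\<close>.\<close>
      fix N assume N: "Suc (Max (range n)) \<le> N"
      have "n s \<le> Max (range n)" for s
        by (rule Max_ge) simp_all
      then have "n s < N" for s
        using N by (meson Suc_le_lessD le_trans Suc_le_mono)
      then show "span ((\<lambda>n. c n \<omega>) ` {..<N}) = UNIV"
        using n by (intro span_eq_UNIV_if_all_sign_patterns) blast
    qed
  qed
qed

section \<open>Convergence for random samples and for any spanning sample set\<close>

text \<open>Too few samples need not span the column space, and the limit can then differ. The first
  conjunct therefore concerns all large \<open>N\<close>, and the second, without randomness, every
  \<open>N\<close> at which the samples span.\<close>

theorem theorem3p2:
  fixes M :: "'w measure"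
    and A :: "real ^ 'n ^ 'n"
    and B U :: "real ^ 'q ^ 'n"
    and D V :: "real ^ 'q ^ 'q"
    and p :: nat
    and c :: "nat \<Rightarrow> 'w \<Rightarrow> real ^ 'q"
    and f u :: "nat \<Rightarrow> 'w \<Rightarrow> real ^ 'n"
  assumes "prob_space M"
    and "CARD('q) = p + 1"
    and "rank B = p + 1"
    and "is_svd B U D V"
    and "prob_space.indep_vars M (\<lambda>_. borel) (\<lambda>(n, i) \<omega>. c n \<omega> $ i) (UNIV :: (nat \<times> 'q) set)"
    and "\<And>n i. distr M borel (\<lambda>\<omega>. c n \<omega> $ i) = distr M borel (\<lambda>\<omega>. c 0 \<omega> $ i)"
    and "\<And>n i. integrable M (\<lambda>\<omega>. c n \<omega> $ i)"
    and "\<And>n i. prob_space.expectation M (\<lambda>\<omega>. c n \<omega> $ i) = 0"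
    and "\<And>n i. \<not> (AE \<omega> in M. c n \<omega> $ i = 0)"
    and "\<And>n \<omega>. \<omega> \<in> space M \<Longrightarrow> f n \<omega> = B *v c n \<omega>"
    and "\<And>n \<omega>. \<omega> \<in> space M \<Longrightarrow> u n \<omega> = A *v f n \<omega>"
  shows "(AE \<omega> in M. \<forall>\<^sub>F N in sequentially. \<forall>W0.
            gd_converges_to (training_loss N (\<lambda>n. f n \<omega>) (\<lambda>n. u n \<omega>)) W0
              (A ** U ** transpose U + W0 ** (mat 1 - U ** transpose U)))
       \<and> (\<forall>\<omega>\<in>space M. \<forall>N. span ((\<lambda>n. f n \<omega>) ` {..<N}) = span (columns B) \<longrightarrow> (\<forall>W0.
            gd_converges_to (training_loss N (\<lambda>n. f n \<omega>) (\<lambda>n. u n \<omega>)) W0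
              (A ** U ** transpose U + W0 ** (mat 1 - U ** transpose U))))"
proof -
  interpret prob_space M by fact
  have rank: "rank B = CARD('q)" using assms(2,3) by simp
  have converges: "gd_converges_to (training_loss N (\<lambda>n. f n \<omega>) (\<lambda>n. u n \<omega>)) W0
      (A ** U ** transpose U + W0 ** (mat 1 - U ** transpose U))"
    if "\<omega> \<in> space M" "span ((\<lambda>n. f n \<omega>) ` {..<N}) = span (columns B)" for \<omega> N W0
    using gd_converges_to_projection[OF rank assms(4) assms(11)[OF that(1)] that(2)] .
  have "AE \<omega> in M. \<forall>\<^sub>F N in sequentially. span ((\<lambda>n. c n \<omega>) ` {..<N}) = UNIV"
    using assms(5-9) by (rule AE_eventually_span_samples_eq_UNIV)
  then have "AE \<omega> in M. \<forall>\<^sub>F N in sequentially. \<forall>W0.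
      gd_converges_to (training_loss N (\<lambda>n. f n \<omega>) (\<lambda>n. u n \<omega>)) W0
        (A ** U ** transpose U + W0 ** (mat 1 - U ** transpose U))"
    using AE_space
  proof eventually_elim
    case (elim \<omega>)
    from elim(1) show ?case
    proof eventually_elim
      case (elim N)
      \<comment> \<open>Samples are images of coefficient vectors under \<open>B\<close>, so
        spanning all coefficients yields the range of \<open>B\<close>.\<close>
      have "(\<lambda>n. f n \<omega>) ` {..<N} = (*v) B ` (\<lambda>n. c n \<omega>) ` {..<N}"
        using assms(10)[OF \<open>\<omega> \<in> space M\<close>] by (simp add: image_image)
      then have "span ((\<lambda>n. f n \<omega>) ` {..<N}) = span (columns B)"
        using elim by (simp add: linear_span_image span_columns_eq_range)
      then show ?case
        using converges \<open>\<omega> \<in> space M\<close> by blast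
    qed
  qed
  then show ?thesis
    using converges by blast
qed

end
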